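(* Let $X=(X_1,\ldots,X_N)$ be a family of independent random variables with $X_k$ taking values in a set $\Lambda_k$. Suppose $(\Gamma_k)_{k\in[N]}$ and $\Gamma\subseteq\prod_{j\in[N]}\Gamma_j$ are events with $\Gamma_k\subseteq\Lambda_k$. Let $f:\prod_{j\in[N]}\Lambda_j\to\mathbb{R}$ be a function. Assume that there are numbers $(c_k)_{k\in[N]}$ and $(d_k)_{k\in[N]}$ with $c_k\le d_k$ such that for all $x,\tilde x\in\prod_{j\in[N]}\Gamma_j$ that differ only in the $k$-th coordinate we have $$|f(x)-f(\tilde x)|\le\begin{cases}c_k&\text{if }x\in\Gamma,\\ d_k&\text{otherwise,}\end{cases}$$ and that $|f(x)-f(\tilde x)|\le s$ for all $x,\tilde x\in\prod_{j\in[N]}\Lambda_j$. Then for any numbers $(\gamma_k)_{k\in[N]}$ with $\gamma_k\in(0,1]$ there is an event $\mathcal{B}=\mathcal{B}(\Gamma,(\gamma_k)_{k\in[N]})$ satisfying $$\mathbb{P}(\mathcal{B})\le\sum_{k\in[N]}\gamma_k^{-1}\cdot\mathbb{P}(X\notin\Gamma)\quad\text{and}\quad\neg\mathcal{B}\subseteq\Gamma,$$ such that for $\mu=\mathbb{E}f(X)$, $\Delta=s\,\mathbb{P}(X\notin\Gamma)$, $e_k=\gamma_k(d_k-c_k)$ and any $t\ge0$ we have $$\mathbb{P}(f(X)\ge\mu+t+\Delta\text{ and }\neg\mathcal{B})\le\exp\left(-\frac{t^2}{2\sum_{k\in[N]}(c_k+e_k)^2}\right).$$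
   Context: $[N]=\{1,\ldots,N\}$. Each $\Lambda_k$ is a measurable space, $\Gamma_k\subseteq\Lambda_k$ and $\Gamma$ are measurable, and $f$ is measurable. Events $\mathcal{B},\Gamma$ are identified with subsets of $\prod_{j\in[N]}\Lambda_j$; $\mathbb{P}(\mathcal{B})=\mathbb{P}(X\in\mathcal{B})$ and $\neg\mathcal{B}$ is the complement. The notation $\mathcal{B}=\mathcal{B}(\Gamma,(\gamma_k)_{k\in[N]})$ means that $\mathcal{B}$ depends only on $\Gamma$ and $(\gamma_k)$ (and the law of $X$), not on $f$ or $t$. *)

theory Defs
  imports "HOL-Probability.Probability"
begin

definition joint :: "nat \<Rightarrow> (nat \<Rightarrow> 'w \<Rightarrow> 'a) \<Rightarrow> 'w \<Rightarrow> nat \<Rightarrow> 'a" where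
  "joint N X \<omega> = (\<lambda>k\<in>{1..N}. X k \<omega>)"

definition differ_only_at :: "nat \<Rightarrow> nat \<Rightarrow> (nat \<Rightarrow> 'a) \<Rightarrow> (nat \<Rightarrow> 'a) \<Rightarrow> bool" where
  "differ_only_at N k x y \<longleftrightarrow> x k \<noteq> y k \<and> (\<forall>j\<in>{1..N} - {k}. x j = y j)"

text \<open>
  The number exp (- t^2 / (2 v)). For v = 0 the HOL convention x / 0 = 0 would turn it into the
  trivial bound 1; instead, the value at v = 0 and t > 0 is the limit 0 for v tending to 0 from
  the right.
\<close>
definition gaussian_tail :: "real \<Rightarrow> real \<Rightarrow> real" where
  "gaussian_tail v t = (if v = 0 then (if t = 0 then 1 else 0) else exp (- (t\<^sup>2 / (2 * v))))"

end

theory Submission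
  imports Defs "HOL-Real_Asymp.Real_Asymp"
begin

text \<open>
  Let $h$ be the indicator of the complement of $\Gamma$ and consider the Doob martingale of $f$.
  Since the Lipschitz condition may be used with either of the two points in $\Gamma$, the $k$-th
  increment is at most
  $c_k + (d_k - c_k)\, E(h \mid X_1, \ldots, X_{k-1})$ in absolute value. So it is at most
  $c_k + e_k$ unless $E(h \mid X_1, \ldots, X_{k-1}) > \gamma_k$. This exceptional event is
  predictable, so the exponential moment of $f$ off all these events can be bounded one coordinate
  at a time by Hoeffding's lemma, and by Markov's inequality the $k$-th event has probability at
  most $\gamma_k^{-1}\, P(X \notin \Gamma)$.
\<close>

section \<open>Conditional expectations given an initial segment of the coordinates\<close>

text \<open>
  On a product space, averaging over the coordinates \<open>k, \<dots>, N\<close> is the conditional expectation given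
  the coordinates \<open>1, \<dots>, k - 1\<close>.
\<close>
primrec coord_avg ::
    "('i \<Rightarrow> 'a measure) \<Rightarrow> 'i list \<Rightarrow> (('i \<Rightarrow> 'a) \<Rightarrow> real) \<Rightarrow> ('i \<Rightarrow> 'a) \<Rightarrow> real" where
  "coord_avg \<nu> [] g = g"
| "coord_avg \<nu> (j # js) g = (\<lambda>x. \<integral>a. coord_avg \<nu> js g (x(j := a)) \<partial>\<nu> j)"

text \<open>The intersection of the predictable good events. Each suffix \<open>j # js\<close>
  contributes one condition, which does not depend on the coordinates in that suffix. The recursion
  over suffixes matches the later induction that integrates the coordinates out.\<close>

primrec suffix_avgs_le ::
    "('i \<Rightarrow> 'a measure) \<Rightarrow> (('i \<Rightarrow> 'a) \<Rightarrow> real) \<Rightarrow> ('i \<Rightarrow> real) \<Rightarrow> 'i list \<Rightarrow> ('i \<Rightarrow> 'a) \<Rightarrow> bool" where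
  "suffix_avgs_le \<nu> h \<gamma> [] = (\<lambda>x. True)"
| "suffix_avgs_le \<nu> h \<gamma> (j # js) =
    (\<lambda>x. coord_avg \<nu> (j # js) h x \<le> \<gamma> j \<and> suffix_avgs_le \<nu> h \<gamma> js x)"

section \<open>Bounded measurable functions and the Gaussian tail\<close>

text \<open>The bound holds everywhere rather than almost everywhere, so that it survives
  restriction to every fibre of a product space.\<close>

definition bounded_measurable :: "'b measure \<Rightarrow> ('b \<Rightarrow> real) \<Rightarrow> bool" where
  "bounded_measurable M g \<longleftrightarrow> g \<in> borel_measurable M \<and> (\<exists>K. \<forall>x\<in>space M. \<bar>g x\<bar> \<le> K)"

lemma bounded_measurableI:
  "g \<in> borel_measurable M \<Longrightarrow> (\<And>x. x \<in> space M \<Longrightarrow> \<bar>g x\<bar> \<le> K) \<Longrightarrow> bounded_measurable M g"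
  unfolding bounded_measurable_def by blast

lemma bounded_measurableE:
  assumes "bounded_measurable M g"
  obtains K where "K \<ge> 0" "\<And>x. x \<in> space M \<Longrightarrow> \<bar>g x\<bar> \<le> K"
proof -
  obtain K where "\<forall>x\<in>space M. \<bar>g x\<bar> \<le> K"
    using assms unfolding bounded_measurable_def by blast
  then show thesis
    using that[of "\<bar>K\<bar>"] by fastforce
qed

lemma bounded_measurable_imp_measurable [measurable_dest]:
  "bounded_measurable M g \<Longrightarrow> g \<in> borel_measurable M"
  unfolding bounded_measurable_def by blast

lemma bounded_measurable_indicator:
  "A \<in> sets M \<Longrightarrow> bounded_measurable M (indicator A)"
  by (rule bounded_measurableI[of _ _ 1]) (auto simp: indicator_def)

lemma bounded_measurable_exp:
  assumes g: "bounded_measurable M g"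
  shows "bounded_measurable M (\<lambda>x. exp (g x))"
proof -
  note g[measurable]
  obtain K where K: "\<And>x. x \<in> space M \<Longrightarrow> \<bar>g x\<bar> \<le> K"
    using bounded_measurableE[OF g] by blast
  show ?thesis
    by (rule bounded_measurableI[of _ _ "exp K"]) (use K in \<open>auto intro: order_trans[OF abs_ge_self]\<close>)
qed

lemma bounded_measurable_mult:
  assumes g: "bounded_measurable M g" and h: "bounded_measurable M h"
  shows "bounded_measurable M (\<lambda>x. g x * h x)"
proof -
  note g[measurable] h[measurable]
  obtain K L where K: "K \<ge> 0" "\<And>x. x \<in> space M \<Longrightarrow> \<bar>g x\<bar> \<le> K"
    and L: "\<And>x. x \<in> space M \<Longrightarrow> \<bar>h x\<bar> \<le> L"
    using bounded_measurableE[OF g] bounded_measurableE[OF h] by metis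
  show ?thesis
    by (rule bounded_measurableI[of _ _ "K * L"]) (use K L in \<open>auto simp: abs_mult intro: mult_mono\<close>)
qed

lemma bounded_measurable_const: "bounded_measurable M (\<lambda>_. c)"
  by (rule bounded_measurableI[of _ _ "\<bar>c\<bar>"]) auto

text \<open>The limit convention at \<open>v = 0\<close> keeps monotonicity true there, so terms of
  the variance that were replaced by 0 can be restored at the end.\<close>

lemma gaussian_tail_mono:
  assumes "0 \<le> v" "v \<le> w" "0 \<le> t"
  shows "gaussian_tail v t \<le> gaussian_tail w t"
proof (cases "v = 0 \<or> t = 0")
  case True
  then show ?thesis by (auto simp: gaussian_tail_def)
next
  case False
  then have "t\<^sup>2 / (2 * w) \<le> t\<^sup>2 / (2 * v)"
    using assms by (intro divide_left_mono) auto
  then show ?thesis using False assms by (simp add: gaussian_tail_def)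
qed

lemma gaussian_tail_nonneg: "0 \<le> gaussian_tail v t"
  by (simp add: gaussian_tail_def)

section \<open>Integral estimates on a single probability space\<close>

lemma (in prob_space) integrable_bounded_measurable:
  "bounded_measurable M g \<Longrightarrow> integrable M g"
  unfolding bounded_measurable_def by (auto intro!: integrable_const_bound AE_I2)

lemma (in prob_space) abs_integral_le_const:
  fixes g :: "'a \<Rightarrow> real"
  assumes [measurable]: "g \<in> borel_measurable M" and K: "\<And>x. x \<in> space M \<Longrightarrow> \<bar>g x\<bar> \<le> K"
  shows "\<bar>\<integral>x. g x \<partial>M\<bar> \<le> K"
proof -
  have int: "integrable M g"
    by (rule integrable_const_bound[of _ K]) (use K in auto)
  have "\<bar>\<integral>x. g x \<partial>M\<bar> \<le> (\<integral>x. \<bar>g x\<bar> \<partial>M)"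
    using integral_norm_bound[of M g] by simp
  also have "\<dots> \<le> (\<integral>x. K \<partial>M)"
    by (rule integral_mono) (use int K in auto)
  finally show ?thesis by (simp add: prob_space)
qed

text \<open>Hoeffding's lemma for the centred variable on \<open>{- r..r}\<close>: the interval has
  length \<open>2 * r\<close>, so the usual \<open>l\<^sup>2 * (2 * r)\<^sup>2 / 8\<close> becomes
  \<open>l\<^sup>2 / 2 * r\<^sup>2\<close>.\<close>

lemma (in prob_space) exp_deviation_le:
  fixes g :: "'a \<Rightarrow> real"
  assumes [measurable]: "g \<in> borel_measurable M"
    and dev: "\<And>x. x \<in> space M \<Longrightarrow> \<bar>g x - m\<bar> \<le> r"
    and m: "m = (\<integral>x. g x \<partial>M)" and "l > 0"
  shows "(\<integral>x. exp (l * g x) \<partial>M) \<le> exp (l * m + l\<^sup>2 / 2 * r\<^sup>2)"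
proof -
  have range: "g x - m \<in> {- r..r}" if "x \<in> space M" for x
    using dev[OF that] unfolding atLeastAtMost_iff by linarith
  interpret dev: interval_bounded_random_variable M "\<lambda>x. g x - m" "- r" r
    by unfold_locales (measurable, rule AE_I2[OF range])
  have "integrable M (\<lambda>x. g x - m)" by (rule dev.integrable)
  then have "integrable M (\<lambda>x. (g x - m) + m)" by (intro Bochner_Integration.integrable_add) auto
  then have int: "integrable M g" by simp
  have zero: "(\<integral>x. g x - m \<partial>M) = 0"
    using int by (simp add: m prob_space)
  have "(\<integral>x. exp (l * (g x - m)) \<partial>M) \<le> exp (l\<^sup>2 * (r - (- r))\<^sup>2 / 8)"
    using dev.Hoeffdings_lemma_nn_integral_0[OF \<open>l > 0\<close> zero]
    by (subst integral_eq_nn_integral) (auto intro!: enn2real_leI)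
  then have "exp (l * m) * (\<integral>x. exp (l * (g x - m)) \<partial>M) \<le> exp (l * m) * exp (l\<^sup>2 / 2 * r\<^sup>2)"
    by (simp add: power2_eq_square field_simps)
  also have "exp (l * m) * (\<integral>x. exp (l * (g x - m)) \<partial>M) = (\<integral>x. exp (l * g x) \<partial>M)"
    by (subst integral_mult_right_zero[symmetric]) (simp add: algebra_simps flip: exp_add)
  finally show ?thesis by (simp add: exp_add)
qed

section \<open>Resampling and averaging coordinates on a product space\<close>

context finite_product_prob_space
begin

abbreviation "P \<equiv> PiM I M"

abbreviation "avg \<equiv> coord_avg M"

abbreviation "good \<equiv> suffix_avgs_le M"

lemma fun_upd_in_space:
  "x \<in> space P \<Longrightarrow> j \<in> I \<Longrightarrow> a \<in> space (M j) \<Longrightarrow> x(j := a) \<in> space P"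
  by (auto simp: space_PiM PiE_iff extensional_def)

lemma measurable_resample [measurable]:
  "j \<in> I \<Longrightarrow> (\<lambda>(x, a). x(j := a)) \<in> measurable (P \<Otimes>\<^sub>M M j) P"
  unfolding case_prod_beta by (rule measurable_fun_upd[of I I]) auto

lemma measurable_resample_at:
  "j \<in> I \<Longrightarrow> x \<in> space P \<Longrightarrow> (\<lambda>a. x(j := a)) \<in> measurable (M j) P"
  by (rule measurable_fun_upd[of I I]) auto

lemma bounded_measurable_resample_at:
  assumes g: "bounded_measurable P g" and j: "j \<in> I" and x: "x \<in> space P"
  shows "bounded_measurable (M j) (\<lambda>a. g (x(j := a)))"
proof -
  obtain K where "\<And>x. x \<in> space P \<Longrightarrow> \<bar>g x\<bar> \<le> K"
    using bounded_measurableE[OF g] by blast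
  then show ?thesis
    using measurable_compose[OF measurable_resample_at[OF j x] bounded_measurable_imp_measurable[OF g]]
    by (intro bounded_measurableI[of _ _ K]) (auto intro!: fun_upd_in_space j x)
qed

lemma integrable_resample:
  "bounded_measurable P g \<Longrightarrow> j \<in> I \<Longrightarrow> x \<in> space P \<Longrightarrow> integrable (M j) (\<lambda>a. g (x(j := a)))"
  by (intro M.integrable_bounded_measurable bounded_measurable_resample_at)

lemma bounded_measurable_integral_resample:
  assumes g: "bounded_measurable P g" and j: "j \<in> I"
  shows "bounded_measurable P (\<lambda>x. \<integral>a. g (x(j := a)) \<partial>M j)"
proof -
  note g[measurable] j[measurable]
  obtain K where K: "\<And>x. x \<in> space P \<Longrightarrow> \<bar>g x\<bar> \<le> K"
    using bounded_measurableE[OF g] by blast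
  have "(\<lambda>(x, a). g (x(j := a))) \<in> borel_measurable (P \<Otimes>\<^sub>M M j)"
    using measurable_compose[OF measurable_resample[OF j] bounded_measurable_imp_measurable[OF g]]
    by (simp add: case_prod_beta)
  then have "(\<lambda>x. \<integral>a. g (x(j := a)) \<partial>M j) \<in> borel_measurable P"
    by (rule M.borel_measurable_lebesgue_integral)
  moreover have "\<bar>\<integral>a. g (x(j := a)) \<partial>M j\<bar> \<le> K" if x: "x \<in> space P" for x
    by (rule M.abs_integral_le_const)
      (auto intro!: K fun_upd_in_space x j bounded_measurable_imp_measurable
        bounded_measurable_resample_at[OF g])
  ultimately show ?thesis by (rule bounded_measurableI)
qed

lemma bounded_measurable_avg:
  "bounded_measurable P g \<Longrightarrow> set js \<subseteq> I \<Longrightarrow> bounded_measurable P (avg js g)"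
proof (induction js)
  case (Cons j js)
  then show ?case
    using bounded_measurable_integral_resample[of "avg js g" j] by simp
next
  case Nil
  then show ?case by (simp add: bounded_measurable_def)
qed

text \<open>Resampling one independent coordinate preserves the law. By Fubini both sides integrate
  coordinate \<open>j\<close> innermost, and on the left the integrand is already constant in
  it.\<close>

lemma integral_integral_resample:
  assumes g: "bounded_measurable P g" and j: "j \<in> I"
  shows "(\<integral>x. (\<integral>a. g (x(j := a)) \<partial>M j) \<partial>P) = (\<integral>x. g x \<partial>P)"
proof -
  have I: "insert j (I - {j}) = I" using j by blast
  have fin: "finite (I - {j})" using finite_index by blast
  have expand: "(\<integral>x. u x \<partial>P) = (\<integral>x. (\<integral>a. u (x(j := a)) \<partial>M j) \<partial>PiM (I - {j}) M)"
    if "bounded_measurable P u" for u :: "_ \<Rightarrow> real"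
    using product_integral_insert[OF fin, of j u] P.integrable_bounded_measurable[OF that]
    unfolding I by simp
  show ?thesis
    unfolding expand[OF bounded_measurable_integral_resample[OF g j]] expand[OF g]
    by (simp add: M.prob_space)
qed

lemma integral_avg:
  "bounded_measurable P g \<Longrightarrow> set js \<subseteq> I \<Longrightarrow> (\<integral>x. avg js g x \<partial>P) = (\<integral>x. g x \<partial>P)"
proof (induction js)
  case (Cons j js)
  then show ?case
    using integral_integral_resample[OF bounded_measurable_avg[of g js]] by simp
qed simp

text \<open>The comparison is required only on the fibre through \<open>x\<close>, so it may use
  properties that are fixed by the coordinates outside \<open>js\<close>.\<close>

lemma avg_mono:
  assumes "bounded_measurable P g" "bounded_measurable P h" "set js \<subseteq> I" "x \<in> space P"
    and "\<And>y. y \<in> space P \<Longrightarrow> (\<And>i. i \<notin> set js \<Longrightarrow> y i = x i) \<Longrightarrow> g y \<le> h y"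
  shows "avg js g x \<le> avg js h x"
  using assms
proof (induction js arbitrary: x)
  case (Cons j js)
  have "avg js g (x(j := a)) \<le> avg js h (x(j := a))" if "a \<in> space (M j)" for a
  proof (rule Cons.IH)
    show "x(j := a) \<in> space P" using Cons.prems that by (intro fun_upd_in_space) auto
  qed (use Cons.prems in auto)
  then show ?case
    using Cons.prems by (auto intro!: integral_mono integrable_resample bounded_measurable_avg)
qed simp

lemma avg_const: "avg js (\<lambda>_. c) x = c"
  by (induction js arbitrary: x) (auto simp: M.prob_space)

text \<open>Predictability: every coordinate in \<open>js\<close> is overwritten before
  \<open>g\<close> is evaluated.\<close>

lemma avg_indep:
  assumes "set js \<subseteq> I" "x \<in> space P" "y \<in> space P" "\<And>i. i \<notin> set js \<Longrightarrow> y i = x i"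
  shows "avg js g y = avg js g x"
  using assms
proof (induction js arbitrary: x y)
  case Nil
  then have "y = x" by auto
  then show ?case by simp
next
  case (Cons j js)
  have "avg js g (y(j := a)) = avg js g (x(j := a))" if "a \<in> space (M j)" for a
  proof (rule Cons.IH)
    show "x(j := a) \<in> space P" "y(j := a) \<in> space P"
      using Cons.prems that by (auto simp del: fun_upd_apply intro: fun_upd_in_space)
  qed (use Cons.prems in auto)
  then show ?case
    by (auto intro!: Bochner_Integration.integral_cong)
qed

text \<open>With no coordinate left fixed the average is constant on the space, and averaging
  preserves the mean.\<close>

lemma avg_full:
  assumes g: "bounded_measurable P g" and js: "set js = I" and x: "x \<in> space P"
  shows "avg js g x = (\<integral>y. g y \<partial>P)"
proof -
  have "avg js g y = avg js g x" if y: "y \<in> space P" for y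
    by (rule avg_indep) (use js x y in \<open>auto simp: space_PiM PiE_iff extensional_def\<close>)
  then have "(\<integral>y. avg js g y \<partial>P) = avg js g x"
    by (subst Bochner_Integration.integral_cong[where g = "\<lambda>_. avg js g x"]) (auto simp: P.prob_space)
  then show ?thesis using integral_avg[OF g, of js] js by simp
qed

section \<open>Martingale increments and the exceptional event\<close>

text \<open>A coupling: both points receive the same resampled coordinates, so they still differ at
  most at \<open>k\<close> and the Lipschitz bound can be averaged. The term \<open>h\<close> stays
  at \<open>y\<close>, so that it can later be integrated over the value of \<open>y\<close> at
  \<open>k\<close>.\<close>

lemma avg_diff_le:
  assumes f: "bounded_measurable P f" and h: "bounded_measurable P h" and js: "set js \<subseteq> I"
    and k: "k \<notin> set js" and "x \<in> space P" "y \<in> space P" "\<And>i. i \<noteq> k \<Longrightarrow> y i = x i"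
    and lip: "\<And>x y. x \<in> space P \<Longrightarrow> y \<in> space P \<Longrightarrow> (\<And>i. i \<noteq> k \<Longrightarrow> y i = x i) \<Longrightarrow>
      \<bar>f x - f y\<bar> \<le> c + e * h y"
  shows "\<bar>avg js f x - avg js f y\<bar> \<le> c + e * avg js h y"
  using js k assms(5-7)
proof (induction js arbitrary: x y)
  case Nil
  then show ?case using lip by simp
next
  case (Cons j js)
  have j: "j \<in> I" and js: "set js \<subseteq> I" using Cons.prems by auto
  note int = integrable_resample[OF bounded_measurable_avg[OF _ js] j, OF f Cons.prems(3)]
    integrable_resample[OF bounded_measurable_avg[OF _ js] j, OF f Cons.prems(4)]
    integrable_resample[OF bounded_measurable_avg[OF _ js] j, OF h Cons.prems(4)]
  have "\<bar>avg (j # js) f x - avg (j # js) f y\<bar>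
      = \<bar>\<integral>a. avg js f (x(j := a)) - avg js f (y(j := a)) \<partial>M j\<bar>"
    using int by simp
  also have "\<dots> \<le> (\<integral>a. \<bar>avg js f (x(j := a)) - avg js f (y(j := a))\<bar> \<partial>M j)"
    by (rule integral_abs_bound)
  also have "\<dots> \<le> (\<integral>a. c + e * avg js h (y(j := a)) \<partial>M j)"
    by (rule integral_mono)
      (use Cons.prems int j js in \<open>auto intro!: Cons.IH fun_upd_in_space\<close>)
  also have "\<dots> = c + e * avg (j # js) h y"
    using int by (simp add: M.prob_space)
  finally show ?case .
qed

lemma pred_good:
  "bounded_measurable P h \<Longrightarrow> set js \<subseteq> I \<Longrightarrow> Measurable.pred P (good h \<gamma> js)"
proof (induction js)
  case (Cons j js)
  have [measurable]: "avg (j # js) h \<in> borel_measurable P"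
    by (rule bounded_measurable_imp_measurable[OF bounded_measurable_avg[OF Cons.prems]])
  have [measurable]: "Measurable.pred P (good h \<gamma> js)" using Cons by simp
  have "Measurable.pred P (\<lambda>x. avg (j # js) h x \<le> \<gamma> j \<and> good h \<gamma> js x)" by measurable
  then show ?case by simp
qed simp

text \<open>Union bound, with Markov's inequality for each condition; every average of
  \<open>h\<close> has the same mean as \<open>h\<close>.\<close>

lemma prob_not_good_le:
  assumes h: "bounded_measurable P h" "\<And>x. x \<in> space P \<Longrightarrow> 0 \<le> h x"
    and "set js \<subseteq> I" "distinct js" "\<And>j. j \<in> set js \<Longrightarrow> 0 < \<gamma> j"
  shows "measure P {x \<in> space P. \<not> good h \<gamma> js x} \<le> (\<Sum>j\<in>set js. inverse (\<gamma> j)) * (\<integral>x. h x \<partial>P)"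
  using assms(3-)
proof (induction js)
  case (Cons j js)
  note bm = bounded_measurable_avg[OF h(1) Cons.prems(1)]
  have nonneg: "0 \<le> avg (j # js) h x" if "x \<in> space P" for x
    using avg_mono[OF bounded_measurable_const[of _ 0] h(1) Cons.prems(1) that] h(2)
    by (simp only: avg_const)
  have [measurable]: "avg (j # js) h \<in> borel_measurable P" "Measurable.pred P (good h \<gamma> js)"
    using bm Cons.prems by (auto intro!: pred_good h bounded_measurable_imp_measurable)
  have "measure P {x \<in> space P. \<gamma> j \<le> avg (j # js) h x} \<le> (\<integral>x. avg (j # js) h x \<partial>P) / \<gamma> j"
    using Cons.prems nonneg
    by (intro integral_Markov_inequality_measure[of _ _ "{}"] P.integrable_bounded_measurable bm) auto
  then have markov: "measure P {x \<in> space P. \<gamma> j \<le> avg (j # js) h x} \<le> inverse (\<gamma> j) * (\<integral>x. h x \<partial>P)"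
    unfolding integral_avg[OF h(1) Cons.prems(1)] by (simp add: field_simps)
  have [measurable]: "{x \<in> space P. \<gamma> j \<le> avg (j # js) h x} \<in> sets P"
    "{x \<in> space P. \<not> good h \<gamma> js x} \<in> sets P"
    by measurable
  have "measure P {x \<in> space P. \<not> good h \<gamma> (j # js) x}
      \<le> measure P ({x \<in> space P. \<gamma> j \<le> avg (j # js) h x} \<union> {x \<in> space P. \<not> good h \<gamma> js x})"
    by (rule P.finite_measure_mono) (auto simp del: coord_avg.simps)
  also have "\<dots> \<le> measure P {x \<in> space P. \<gamma> j \<le> avg (j # js) h x}
      + measure P {x \<in> space P. \<not> good h \<gamma> js x}"
    by (rule measure_Un_le) measurable
  also have "\<dots> \<le> inverse (\<gamma> j) * (\<integral>x. h x \<partial>P) + (\<Sum>j\<in>set js. inverse (\<gamma> j)) * (\<integral>x. h x \<partial>P)"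
    using markov Cons by (intro add_mono) auto
  finally show ?case using Cons.prems by (simp add: algebra_simps)
qed simp

section \<open>Exponential moments and the Chernoff bound\<close>

lemma bounded_measurable_exp_good:
  assumes f: "bounded_measurable P f" and h: "bounded_measurable P h" and js: "set js \<subseteq> I"
  shows "bounded_measurable P (\<lambda>y. exp (l * f y) * indicator {y. good h \<gamma> js y} y)"
proof -
  have [measurable]: "Measurable.pred P (good h \<gamma> js)" by (rule pred_good[OF h js])
  have "bounded_measurable P (\<lambda>y. indicator {y. good h \<gamma> js y} y)"
    by (rule bounded_measurableI[of _ _ 1]) (auto simp: indicator_def)
  then show ?thesis
    by (intro bounded_measurable_mult bounded_measurable_exp bounded_measurable_const f)
qed

text \<open>The induction integrates the coordinates out from the last to the first. The condition
  at the head \<open>j\<close> is fixed by the coordinates that are not averaged: either it fails on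
  the whole fibre and the indicator vanishes there, or Hoeffding's lemma applies to coordinate
  \<open>j\<close> with radius \<open>c j + e j * \<gamma> j\<close>.\<close>

lemma avg_exp_good_le:
  assumes f: "bounded_measurable P f" and h: "bounded_measurable P h" and "l > 0"
    and "set js \<subseteq> I" "distinct js" "x \<in> space P" "\<And>k. k \<in> set js \<Longrightarrow> 0 \<le> e k"
    and "\<And>k x y. k \<in> set js \<Longrightarrow> x \<in> space P \<Longrightarrow> y \<in> space P \<Longrightarrow> (\<And>i. i \<noteq> k \<Longrightarrow> y i = x i) \<Longrightarrow>
      \<bar>f x - f y\<bar> \<le> c k + e k * h y"
  shows "avg js (\<lambda>y. exp (l * f y) * indicator {y. good h \<gamma> js y} y) x
    \<le> exp (l * avg js f x + l\<^sup>2 / 2 * (\<Sum>k\<in>set js. (c k + e k * \<gamma> k)\<^sup>2))"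
  using assms(4-)
proof (induction js arbitrary: x)
  case Nil
  then show ?case by simp
next
  case (Cons j js)
  have j: "j \<in> I" and js: "set js \<subseteq> I" "distinct js" "j \<notin> set js" using Cons.prems by auto
  define E where "E = (\<lambda>js y. exp (l * f y) * indicator {y. good h \<gamma> js y} y)"
  have E: "bounded_measurable P (E js)" if "set js \<subseteq> I" for js
    unfolding E_def by (rule bounded_measurable_exp_good[OF f h that])
  define S where "S = l\<^sup>2 / 2 * (\<Sum>k\<in>set js. (c k + e k * \<gamma> k)\<^sup>2)"
  define r where "r = c j + e j * \<gamma> j"
  define g where "g = (\<lambda>a. avg js f (x(j := a)))"
  define m where "m = avg (j # js) f x"
  show ?case
  proof (cases "avg (j # js) h x \<le> \<gamma> j")
    case False
    have "avg (j # js) (E (j # js)) x \<le> avg (j # js) (\<lambda>_. 0) x"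
    proof (rule avg_mono[OF E bounded_measurable_const])
      fix y assume "y \<in> space P" "\<And>i. i \<notin> set (j # js) \<Longrightarrow> y i = x i"
      then have "avg (j # js) h y = avg (j # js) h x"
        using Cons.prems by (intro avg_indep) auto
      then show "E (j # js) y \<le> 0" using False by (auto simp: E_def)
    qed (use Cons.prems in auto)
    then show ?thesis unfolding E_def avg_const
      by (meson exp_ge_zero order_trans)
  next
    case True
    have g: "bounded_measurable (M j) g"
      unfolding g_def by (intro bounded_measurable_resample_at bounded_measurable_avg f j js Cons.prems)
    have int_g: "integrable (M j) g" by (rule M.integrable_bounded_measurable[OF g])
    have m: "m = (\<integral>a. g a \<partial>M j)" by (simp add: m_def g_def)
    \<comment> \<open>In the comparison with an independent copy \<open>b\<close> of the coordinate,
      \<open>h\<close> is charged at the point carrying \<open>b\<close>. Integrating over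
      \<open>b\<close> turns it into the average that is at most \<open>\<gamma> j\<close> in this
      case.\<close>
    have dev: "\<bar>g a - m\<bar> \<le> r" if a: "a \<in> space (M j)" for a
    proof -
      have int_h: "integrable (M j) (\<lambda>b. avg js h (x(j := b)))"
        by (intro integrable_resample bounded_measurable_avg h j js Cons.prems)
      have "\<bar>g a - m\<bar> = \<bar>\<integral>b. g a - g b \<partial>M j\<bar>"
        using int_g by (simp add: m M.prob_space)
      also have "\<dots> \<le> (\<integral>b. \<bar>g a - g b\<bar> \<partial>M j)"
        by (rule integral_abs_bound)
      also have "\<dots> \<le> (\<integral>b. c j + e j * avg js h (x(j := b)) \<partial>M j)"
      proof (rule integral_mono)
        fix b assume "b \<in> space (M j)"
        then show "\<bar>g a - g b\<bar> \<le> c j + e j * avg js h (x(j := b))"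
          unfolding g_def using Cons.prems a
          by (intro avg_diff_le[OF f h js(1) js(3)] fun_upd_in_space) auto
      qed (use int_g int_h in auto)
      also have "\<dots> = c j + e j * avg (j # js) h x"
        using int_h by (simp add: M.prob_space)
      also have "\<dots> \<le> r"
        unfolding r_def using True Cons.prems(4)[of j] by (simp add: mult_left_mono)
      finally show ?thesis .
    qed
    \<comment> \<open>Dropping the condition at \<open>j\<close> from the indicator leaves the
      function of the induction hypothesis.\<close>
    have "avg (j # js) (E (j # js)) x \<le> avg (j # js) (E js) x"
      by (rule avg_mono[OF E E]) (use Cons.prems in \<open>auto simp: E_def indicator_def\<close>)
    also have "\<dots> = (\<integral>a. avg js (E js) (x(j := a)) \<partial>M j)"
      by simp
    also have "\<dots> \<le> (\<integral>a. exp S * exp (l * g a) \<partial>M j)"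
    proof (rule integral_mono)
      show "integrable (M j) (\<lambda>a. avg js (E js) (x(j := a)))"
        by (intro integrable_resample bounded_measurable_avg E j js Cons.prems)
      show "integrable (M j) (\<lambda>a. exp S * exp (l * g a))"
        by (intro M.integrable_bounded_measurable bounded_measurable_mult bounded_measurable_exp
            bounded_measurable_const g)
      fix a assume a: "a \<in> space (M j)"
      have "avg js (E js) (x(j := a)) \<le> exp (l * avg js f (x(j := a)) + S)"
        unfolding E_def S_def
        by (rule Cons.IH) (use Cons.prems a in \<open>auto simp del: fun_upd_apply intro!: fun_upd_in_space\<close>)
      then show "avg js (E js) (x(j := a)) \<le> exp S * exp (l * g a)"
        by (simp add: g_def exp_add mult.commute)
    qed
    also have "\<dots> \<le> exp S * exp (l * m + l\<^sup>2 / 2 * r\<^sup>2)"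
      using M.exp_deviation_le[OF bounded_measurable_imp_measurable[OF g] dev m \<open>l > 0\<close>]
      by simp
    also have "\<dots> = exp (l * m + l\<^sup>2 / 2 * (\<Sum>k\<in>set (j # js). (c k + e k * \<gamma> k)\<^sup>2))"
      using js(3) by (simp add: S_def r_def algebra_simps flip: exp_add)
    finally show ?thesis unfolding E_def m_def .
  qed
qed

text \<open>The exponential Markov inequality on the good event. Over the full index list the
  average is the expectation, so \<open>avg_exp_good_le\<close> bounds the exponential
  moment.\<close>

lemma prob_good_deviation_le:
  assumes f: "bounded_measurable P f" and h: "bounded_measurable P h"
    and js: "set js = I" "distinct js" and e: "\<And>k. k \<in> I \<Longrightarrow> 0 \<le> e k"
    and lip: "\<And>k x y. k \<in> I \<Longrightarrow> x \<in> space P \<Longrightarrow> y \<in> space P \<Longrightarrow> (\<And>i. i \<noteq> k \<Longrightarrow> y i = x i) \<Longrightarrow>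
      \<bar>f x - f y\<bar> \<le> c k + e k * h y"
    and "t \<ge> 0"
  shows "measure P {x \<in> space P. (\<integral>x. f x \<partial>P) + t \<le> f x \<and> good h \<gamma> js x}
    \<le> gaussian_tail (\<Sum>k\<in>I. (c k + e k * \<gamma> k)\<^sup>2) t"
proof -
  define A where "A = {x \<in> space P. (\<integral>x. f x \<partial>P) + t \<le> f x \<and> good h \<gamma> js x}"
  define v where "v = (\<Sum>k\<in>I. (c k + e k * \<gamma> k)\<^sup>2)"
  define \<mu> where "\<mu> = (\<integral>x. f x \<partial>P)"
  note f[measurable]
  have [measurable]: "Measurable.pred P (good h \<gamma> js)" by (rule pred_good) (use h js in auto)
  have [measurable]: "A \<in> sets P" unfolding A_def by measurable
  have "v \<ge> 0" unfolding v_def by (simp add: sum_nonneg)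
  have chernoff: "measure P A \<le> exp (l\<^sup>2 / 2 * v - l * t)" if l: "l > 0" for l
  proof -
    define E where "E = (\<lambda>y. exp (l * f y) * indicator {y. good h \<gamma> js y} y)"
    have E: "bounded_measurable P E"
      unfolding E_def using js by (intro bounded_measurable_exp_good f h) simp
    \<comment> \<open>Any base point will do, since an average over all coordinates does not depend
      on it.\<close>
    obtain x where x: "x \<in> space P" using P.not_empty by blast
    have "exp (l * (\<mu> + t)) * measure P A = (\<integral>y. exp (l * (\<mu> + t)) * indicator A y \<partial>P)"
      by simp
    also have "\<dots> \<le> (\<integral>y. E y \<partial>P)"
    proof (rule integral_mono)
      show "integrable P E" by (rule P.integrable_bounded_measurable[OF E])
      fix y assume "y \<in> space P"
      show "exp (l * (\<mu> + t)) * indicator A y \<le> E y"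
        using l by (auto simp: A_def E_def \<mu>_def indicator_def)
    qed (auto simp: P.emeasure_eq_measure)
    also have "\<dots> = avg js E x"
      using avg_full[OF E js(1) x] by simp
    also have "\<dots> \<le> exp (l * avg js f x + l\<^sup>2 / 2 * v)"
      unfolding E_def v_def js(1)[symmetric]
      by (rule avg_exp_good_le[OF f h l]) (use js x e lip in auto)
    also have "avg js f x = \<mu>"
      unfolding \<mu>_def by (rule avg_full[OF f js(1) x])
    finally have "measure P A \<le> exp (l * \<mu> + l\<^sup>2 / 2 * v) / exp (l * (\<mu> + t))"
      by (simp add: pos_le_divide_eq mult.commute)
    then show ?thesis
      by (simp add: algebra_simps flip: exp_diff)
  qed
  have "measure P A \<le> gaussian_tail v t"
  proof (cases "t = 0")
    case True
    then show ?thesis by (simp add: gaussian_tail_def)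
  next
    case False
    then have t: "t > 0" using \<open>t \<ge> 0\<close> by simp
    show ?thesis
    proof (cases "v = 0")
      case True
      \<comment> \<open>With zero variance every \<open>l > 0\<close> gives the bound
        \<open>exp (- l * t)\<close>; letting \<open>l\<close> grow yields the value 0 of
        \<open>gaussian_tail\<close>.\<close>
      have "((\<lambda>l. exp (- l * t)) \<longlongrightarrow> 0) at_top"
        using t by real_asymp
      then have "measure P A \<le> 0"
        by (rule tendsto_lowerbound)
          (use chernoff True in \<open>auto intro!: eventually_mono[OF eventually_gt_at_top[of 0]]\<close>)
      then show ?thesis using True t by (simp add: gaussian_tail_def)
    next
      case False
      then have v: "v > 0" using \<open>v \<ge> 0\<close> by simp
      \<comment> \<open>The choice \<open>l = t / v\<close> minimises the exponent
        \<open>l\<^sup>2 / 2 * v - l * t\<close>.\<close>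
      have "(t / v)\<^sup>2 / 2 * v - t / v * t = - (t\<^sup>2 / (2 * v))"
        using v by (simp add: power2_eq_square field_simps)
      then show ?thesis
        using chernoff[of "t / v"] t v by (simp add: gaussian_tail_def)
    qed
  qed
  then show ?thesis by (simp add: A_def v_def)
qed

section \<open>The typical event and the restricted Lipschitz condition\<close>

text \<open>A plain union bound over the complement of \<Gamma> and all conditions has one term too
  many. The first condition averages over all coordinates and is therefore deterministic, and
  splitting on whether it holds saves that term.\<close>

lemma prob_not_typical_le:
  assumes \<Gamma> [measurable]: "\<Gamma> \<in> sets P" and js: "set js = I" "distinct js" "js \<noteq> []"
    and \<gamma>: "\<And>k. k \<in> I \<Longrightarrow> 0 < \<gamma> k \<and> \<gamma> k \<le> 1"
  shows "measure P {x \<in> space P. \<not> (x \<in> \<Gamma> \<and> good (indicator (space P - \<Gamma>)) \<gamma> js x)}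
    \<le> (\<Sum>k\<in>I. inverse (\<gamma> k)) * measure P (space P - \<Gamma>)"
proof -
  define h :: "_ \<Rightarrow> real" where "h = indicator (space P - \<Gamma>)"
  define p where "p = measure P (space P - \<Gamma>)"
  obtain j js' where js_eq: "js = j # js'" using js by (cases js) auto
  have h: "bounded_measurable P h"
    unfolding h_def by (rule bounded_measurable_indicator) measurable
  have int_h: "(\<integral>x. h x \<partial>P) = p"
    unfolding h_def p_def by simp
  have p: "0 \<le> p" by (simp add: p_def)
  have sum: "(\<Sum>k\<in>I. inverse (\<gamma> k)) = inverse (\<gamma> j) + (\<Sum>k\<in>set js'. inverse (\<gamma> k))"
    using js unfolding js_eq by auto
  have \<gamma>j: "0 < \<gamma> j" "\<gamma> j \<le> 1" using \<gamma>[of j] js js_eq by auto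
  have rest: "0 \<le> (\<Sum>k\<in>set js'. inverse (\<gamma> k))"
    using \<gamma> js js_eq by (intro sum_nonneg) (auto simp: less_imp_le)
  define B where "B = {x \<in> space P. \<not> (x \<in> \<Gamma> \<and> good h \<gamma> js x)}"
  have "measure P B \<le> (inverse (\<gamma> j) + (\<Sum>k\<in>set js'. inverse (\<gamma> k))) * p"
  proof (cases "p \<le> \<gamma> j")
    case True
    \<comment> \<open>The first condition of \<open>good\<close> is \<open>p \<le> \<gamma> j\<close>, independently of \<open>x\<close>, so its share
      of the bound is free to pay for the event \<open>- \<Gamma>\<close>.\<close>
    have [measurable]: "Measurable.pred P (good h \<gamma> js')"
      by (rule pred_good[OF h]) (use js js_eq in auto)
    have "good h \<gamma> js x" if "x \<in> space P" "good h \<gamma> js' x" for x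
      using avg_full[OF h js(1) that(1)] that(2) True unfolding js_eq int_h by simp
    then have "B \<subseteq> (space P - \<Gamma>) \<union> {x \<in> space P. \<not> good h \<gamma> js' x}"
      unfolding B_def by blast
    then have "measure P B \<le> measure P ((space P - \<Gamma>) \<union> {x \<in> space P. \<not> good h \<gamma> js' x})"
      by (rule P.finite_measure_mono) measurable
    also have "\<dots> \<le> p + measure P {x \<in> space P. \<not> good h \<gamma> js' x}"
      unfolding p_def by (rule measure_Un_le) measurable
    also have "measure P {x \<in> space P. \<not> good h \<gamma> js' x} \<le> (\<Sum>k\<in>set js'. inverse (\<gamma> k)) * p"
      using prob_not_good_le[OF h, of js' \<gamma>] \<gamma> js js_eq unfolding int_h by (auto simp: h_def)
    finally have "measure P B \<le> p + (\<Sum>k\<in>set js'. inverse (\<gamma> k)) * p" by simp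
    moreover have "p \<le> inverse (\<gamma> j) * p"
      using \<gamma>j p mult_right_mono[of 1 "inverse (\<gamma> j)" p] by (simp add: one_le_inverse)
    ultimately show ?thesis by (simp add: distrib_right)
  next
    case False
    \<comment> \<open>Here \<open>\<gamma> j < p\<close>, so the claimed bound already exceeds
      1.\<close>
    have "measure P B \<le> 1" by simp
    also have "1 \<le> inverse (\<gamma> j) * p" using False \<gamma>j by (simp add: field_simps)
    also have "\<dots> \<le> (inverse (\<gamma> j) + (\<Sum>k\<in>set js'. inverse (\<gamma> k))) * p"
      using rest p by (intro mult_right_mono) auto
    finally show ?thesis .
  qed
  then show ?thesis unfolding B_def h_def p_def sum .
qed

text \<open>The Lipschitz condition is known only on \<open>PiE I G\<close>, while averaging
  resamples over the whole space. Hence \<open>prob_good_deviation_le\<close> is applied to a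
  modification of \<open>f\<close> that agrees with \<open>f\<close> on \<Gamma>, and \<Delta> pays
  for the shift of the mean.\<close>

lemma prob_typical_deviation_le:
  assumes \<Gamma> [measurable]: "\<Gamma> \<in> sets P" and js: "set js = I" "distinct js"
    and \<gamma>: "\<And>k. k \<in> I \<Longrightarrow> 0 < \<gamma> k \<and> \<gamma> k \<le> 1"
    and G: "\<And>k. k \<in> I \<Longrightarrow> G k \<in> sets (M k)" and \<Gamma>G: "\<Gamma> \<subseteq> PiE I G"
    and f [measurable]: "f \<in> borel_measurable P"
    and cd: "\<And>k. k \<in> I \<Longrightarrow> c k \<le> d k"
    and lip: "\<And>k x y. k \<in> I \<Longrightarrow> x \<in> PiE I G \<Longrightarrow> y \<in> PiE I G \<Longrightarrow> x k \<noteq> y k \<Longrightarrow>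
      (\<And>j. j \<in> I - {k} \<Longrightarrow> x j = y j) \<Longrightarrow> \<bar>f x - f y\<bar> \<le> (if x \<in> \<Gamma> then c k else d k)"
    and osc: "\<And>x y. x \<in> space P \<Longrightarrow> y \<in> space P \<Longrightarrow> \<bar>f x - f y\<bar> \<le> s"
    and t: "0 \<le> t"
  shows "measure P {x \<in> space P. (\<integral>x. f x \<partial>P) + t + s * measure P (space P - \<Gamma>) \<le> f x \<and>
      x \<in> \<Gamma> \<and> good (indicator (space P - \<Gamma>)) \<gamma> js x}
    \<le> gaussian_tail (\<Sum>k\<in>I. (c k + \<gamma> k * (d k - c k))\<^sup>2) t"
proof (cases "\<Gamma> = {}")
  case True
  then show ?thesis by (simp add: gaussian_tail_nonneg)
next
  case False
  \<comment> \<open>The base point is taken in \<Gamma>, not merely in \<open>PiE I G\<close>: the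
    Lipschitz bound at \<open>z\<close> is then \<open>c k\<close>, which forces
    \<open>0 \<le> c k\<close> wherever coordinate \<open>k\<close> can move.\<close>
  then obtain z where z: "z \<in> \<Gamma>" by blast
  then have zG: "z \<in> PiE I G" using \<Gamma>G by blast
  have G_space: "PiE I G \<subseteq> space P"
    using G[THEN sets.sets_into_space] by (auto simp: space_PiM PiE_iff)
  then have z_space: "z \<in> space P" using zG by blast
  define h :: "_ \<Rightarrow> real" where "h = indicator (space P - \<Gamma>)"
  have h: "bounded_measurable P h"
    unfolding h_def by (rule bounded_measurable_indicator) measurable
  \<comment> \<open>Retracting every coordinate to \<open>G\<close> makes the Lipschitz conditions global and changes
    the function only off \<open>\<Gamma>\<close>, hence its mean by at most \<open>\<Delta>\<close>.\<close>
  define \<pi> where "\<pi> = (\<lambda>x. \<lambda>k\<in>I. if x k \<in> G k then x k else z k)"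
  have \<pi>_G: "\<pi> x \<in> PiE I G" for x using zG by (auto simp: \<pi>_def)
  have \<pi>_id: "\<pi> x = x" if "x \<in> PiE I G" for x
    using that by (auto simp: \<pi>_def PiE_iff extensional_def)
  have \<pi>_space: "\<pi> x \<in> space P" for x using \<pi>_G G_space by blast
  have \<pi>_meas [measurable]: "\<pi> \<in> measurable P P"
    unfolding \<pi>_def
  proof (rule measurable_restrict)
    fix k assume k [measurable]: "k \<in> I"
    have [measurable]: "G k \<in> sets (M k)" by (rule G[OF k])
    have [measurable]: "z k \<in> space (M k)" using z_space k by (auto simp: space_PiM)
    show "(\<lambda>x. if x k \<in> G k then x k else z k) \<in> measurable P (M k)" by measurable
  qed
  have f_bound: "\<bar>f x\<bar> \<le> \<bar>f z\<bar> + s" if "x \<in> space P" for x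
    using osc[OF that z_space] by linarith
  have f_bdd: "bounded_measurable P f" and f\<pi>_bdd: "bounded_measurable P (\<lambda>x. f (\<pi> x))"
    using f_bound \<pi>_space by (auto intro!: bounded_measurableI[of _ _ "\<bar>f z\<bar> + s"])
  \<comment> \<open>The constants of a coordinate with a one-point \<open>G k\<close> are unconstrained, possibly negative.\<close>
  define free where "free = (\<lambda>k. \<exists>b\<in>G k. b \<noteq> z k)"
  define c' where "c' = (\<lambda>k. if free k then c k else 0)"
  define e where "e = (\<lambda>k. if free k then d k - c k else 0)"
  have e: "0 \<le> e k" if "k \<in> I" for k using cd[OF that] by (simp add: e_def)
  have c': "0 \<le> c' k" if k: "k \<in> I" for k
  proof (cases "free k")
    case True
    then obtain b where b: "b \<in> G k" "b \<noteq> z k" unfolding free_def by blast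
    have "z(k := b) \<in> PiE I G" using zG b k by (auto simp: PiE_iff extensional_def)
    then have "\<bar>f z - f (z(k := b))\<bar> \<le> c k"
      using lip[OF k zG, of "z(k := b)"] b z by auto
    then show ?thesis using True by (simp add: c'_def)
  qed (simp add: c'_def)
  have lip': "\<bar>f (\<pi> x) - f (\<pi> y)\<bar> \<le> c' k + e k * h y"
    if k: "k \<in> I" and y: "y \<in> space P" and xy: "\<And>i. i \<noteq> k \<Longrightarrow> y i = x i" for k x y
  proof (cases "\<pi> x k = \<pi> y k")
    case True
    moreover have "\<pi> x i = \<pi> y i" if "i \<noteq> k" for i
      using xy[OF that] by (simp add: \<pi>_def restrict_def)
    ultimately have "\<pi> x = \<pi> y" by (metis ext)
    then show ?thesis using c'[OF k] e[OF k] by (simp add: h_def)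
  next
    case False
    \<comment> \<open>Both values lie in \<open>G k\<close>, so at least one of them differs from
      \<open>z k\<close>.\<close>
    then have "free k"
      using \<pi>_G[of x] \<pi>_G[of y] k unfolding free_def by (metis PiE_mem)
    have "\<bar>f (\<pi> y) - f (\<pi> x)\<bar> \<le> (if \<pi> y \<in> \<Gamma> then c k else d k)"
      by (rule lip[OF k \<pi>_G \<pi>_G]) (use False xy in \<open>auto simp: \<pi>_def\<close>)
    \<comment> \<open>If \<open>\<pi> y\<close> lies outside \<Gamma>, so does \<open>y\<close>,
      because \<open>\<pi>\<close> fixes \<Gamma> pointwise; then \<open>h y = 1\<close> and the
      right side is \<open>d k\<close>.\<close>
    also have "\<dots> \<le> c' k + e k * h y"
      using \<open>free k\<close> cd[OF k] y \<pi>_id[of y] \<Gamma>G by (auto simp: c'_def e_def h_def indicator_def)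
    finally show ?thesis by (simp add: abs_minus_commute)
  qed
  have "0 \<le> s" using osc[OF z_space z_space] by simp
  have "(\<integral>x. f (\<pi> x) \<partial>P) \<le> (\<integral>x. f x + s * h x \<partial>P)"
  proof (rule integral_mono)
    show "integrable P (\<lambda>x. f x + s * h x)"
      using P.integrable_bounded_measurable[OF f_bdd] P.integrable_bounded_measurable[OF h] by simp
    fix x assume x: "x \<in> space P"
    show "f (\<pi> x) \<le> f x + s * h x"
      using osc[OF \<pi>_space[of x] x] \<pi>_id[of x] \<Gamma>G x by (auto simp: h_def indicator_def)
  qed (rule P.integrable_bounded_measurable[OF f\<pi>_bdd])
  also have "\<dots> = (\<integral>x. f x \<partial>P) + s * measure P (space P - \<Gamma>)"
    using P.integrable_bounded_measurable[OF f_bdd] P.integrable_bounded_measurable[OF h]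
    by (simp add: h_def)
  finally have mean: "(\<integral>x. f (\<pi> x) \<partial>P) \<le> (\<integral>x. f x \<partial>P) + s * measure P (space P - \<Gamma>)" .
  have [measurable]: "Measurable.pred P (good h \<gamma> js)" by (rule pred_good) (use h js in auto)
  have "measure P {x \<in> space P. (\<integral>x. f x \<partial>P) + t + s * measure P (space P - \<Gamma>) \<le> f x \<and>
      x \<in> \<Gamma> \<and> good h \<gamma> js x}
    \<le> measure P {x \<in> space P. (\<integral>x. f (\<pi> x) \<partial>P) + t \<le> f (\<pi> x) \<and> good h \<gamma> js x}"
  proof (rule P.finite_measure_mono)
    show "{x \<in> space P. (\<integral>x. f x \<partial>P) + t + s * measure P (space P - \<Gamma>) \<le> f x \<and>
        x \<in> \<Gamma> \<and> good h \<gamma> js x}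
      \<subseteq> {x \<in> space P. (\<integral>x. f (\<pi> x) \<partial>P) + t \<le> f (\<pi> x) \<and> good h \<gamma> js x}"
    proof safe
      fix x assume "(\<integral>x. f x \<partial>P) + t + s * measure P (space P - \<Gamma>) \<le> f x" "x \<in> \<Gamma>"
      then show "(\<integral>x. f (\<pi> x) \<partial>P) + t \<le> f (\<pi> x)"
        using mean \<pi>_id[of x] \<Gamma>G by auto
    qed
  qed measurable
  also have "\<dots> \<le> gaussian_tail (\<Sum>k\<in>I. (c' k + e k * \<gamma> k)\<^sup>2) t"
    by (rule prob_good_deviation_le[OF f\<pi>_bdd h js e lip' t])
  \<comment> \<open>A coordinate that is not free contributes 0 to the smaller sum and a square to
    the larger one.\<close>
  also have "\<dots> \<le> gaussian_tail (\<Sum>k\<in>I. (c k + \<gamma> k * (d k - c k))\<^sup>2) t"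
    by (rule gaussian_tail_mono)
      (auto intro!: sum_nonneg sum_mono t simp: c'_def e_def mult.commute)
  finally show ?thesis by (simp only: h_def)
qed

end

section \<open>Transfer to independent random variables\<close>

theorem theorem11:
  fixes M :: "'w measure" and N :: nat
    and \<Lambda> :: "nat \<Rightarrow> 'a measure" and X :: "nat \<Rightarrow> 'w \<Rightarrow> 'a"
    and \<Gamma> :: "(nat \<Rightarrow> 'a) set" and \<gamma> :: "nat \<Rightarrow> real"
  assumes "prob_space M"
    and "N \<ge> 1"
    and "prob_space.indep_vars M \<Lambda> X {1..N}"
    and "\<Gamma> \<in> sets (PiM {1..N} \<Lambda>)"
    and "\<And>k. k \<in> {1..N} \<Longrightarrow> 0 < \<gamma> k \<and> \<gamma> k \<le> 1"
  shows "\<exists>B \<in> sets (PiM {1..N} \<Lambda>).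
    measure M {\<omega> \<in> space M. joint N X \<omega> \<in> B}
      \<le> (\<Sum>k\<in>{1..N}. inverse (\<gamma> k)) * measure M {\<omega> \<in> space M. joint N X \<omega> \<notin> \<Gamma>} \<and>
    space (PiM {1..N} \<Lambda>) - B \<subseteq> \<Gamma> \<and>
    (\<forall>(G :: nat \<Rightarrow> 'a set) (f :: (nat \<Rightarrow> 'a) \<Rightarrow> real) (c :: nat \<Rightarrow> real) (d :: nat \<Rightarrow> real) (s :: real).
      (\<forall>k\<in>{1..N}. G k \<in> sets (\<Lambda> k)) \<longrightarrow>
      \<Gamma> \<subseteq> (\<Pi>\<^sub>E j\<in>{1..N}. G j) \<longrightarrow>
      f \<in> borel_measurable (PiM {1..N} \<Lambda>) \<longrightarrow>
      (\<forall>k\<in>{1..N}. c k \<le> d k) \<longrightarrow>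
      (\<forall>k\<in>{1..N}. \<forall>x \<in> (\<Pi>\<^sub>E j\<in>{1..N}. G j). \<forall>y \<in> (\<Pi>\<^sub>E j\<in>{1..N}. G j).
        differ_only_at N k x y \<longrightarrow> \<bar>f x - f y\<bar> \<le> (if x \<in> \<Gamma> then c k else d k)) \<longrightarrow>
      (\<forall>x \<in> space (PiM {1..N} \<Lambda>). \<forall>y \<in> space (PiM {1..N} \<Lambda>). \<bar>f x - f y\<bar> \<le> s) \<longrightarrow>
      (let \<mu> = (\<integral>\<omega>. f (joint N X \<omega>) \<partial>M);
           \<Delta> = s * measure M {\<omega> \<in> space M. joint N X \<omega> \<notin> \<Gamma>};
           e = (\<lambda>k. \<gamma> k * (d k - c k))
       in \<forall>t\<ge>0. measure M {\<omega> \<in> space M. f (joint N X \<omega>) \<ge> \<mu> + t + \<Delta> \<and> joint N X \<omega> \<notin> B}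
            \<le> gaussian_tail (\<Sum>k\<in>{1..N}. (c k + e k)\<^sup>2) t))"
proof -
  interpret M: prob_space M by fact
  define I where "I = {1..N}"
  \<comment> \<open>In increasing order the suffix that starts at \<open>k\<close> consists of the
    coordinates from \<open>k\<close> to \<open>N\<close>.\<close>
  define js where "js = [1..<Suc N]"
  have js: "set js = I" "distinct js" "js \<noteq> []"
    using \<open>N \<ge> 1\<close> by (auto simp: js_def I_def)
  have X [measurable]: "X k \<in> measurable M (\<Lambda> k)" if "k \<in> I" for k
    using assms(3) that unfolding M.indep_vars_def I_def by blast
  have "1 \<in> I" using \<open>N \<ge> 1\<close> by (simp add: I_def)
  \<comment> \<open>The product locale wants a probability measure at every index; outside
    \<open>I\<close> the law of \<open>X 1\<close> serves as the default.\<close>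
  define \<nu> where
    "\<nu> = (\<lambda>k. if k \<in> I then distr M (\<Lambda> k) (X k) else distr M (\<Lambda> 1) (X 1))"
  have \<nu>: "prob_space (\<nu> k)" for k
    using X \<open>1 \<in> I\<close> by (auto simp: \<nu>_def intro!: M.prob_space_distr)
  interpret prob_space "\<nu> k" for k by (rule \<nu>)
  interpret finite_product_prob_space \<nu> I
    by unfold_locales (auto simp: I_def)
  define J where "J = joint N X"
  have J_eq: "J = (\<lambda>\<omega>. \<lambda>k\<in>I. X k \<omega>)"
    by (simp add: J_def joint_def[abs_def] I_def)
  have J_meas [measurable]: "J \<in> measurable M (PiM I \<Lambda>)"
    unfolding J_eq by (intro measurable_restrict X)
  have sets_\<nu>: "sets (\<nu> k) = sets (\<Lambda> k)" if "k \<in> I" for k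
    using that by (simp add: \<nu>_def)
  have sets_P: "sets (PiM I \<nu>) = sets (PiM I \<Lambda>)"
    by (rule sets_PiM_cong) (auto simp: sets_\<nu>)
  have space_P: "space (PiM I \<nu>) = space (PiM I \<Lambda>)"
    by (rule sets_eq_imp_space_eq[OF sets_P])
  \<comment> \<open>Independence identifies the joint law with the product of the marginal laws, so
    the bounds on the product space carry over to \<open>M\<close>.\<close>
  have "distr M (PiM I \<Lambda>) (\<lambda>\<omega>. \<lambda>k\<in>I. X k \<omega>) = PiM I (\<lambda>k. distr M (\<Lambda> k) (X k))"
    using M.indep_vars_iff_distr_eq_PiM'[of I X \<Lambda>] \<open>1 \<in> I\<close> X assms(3) unfolding I_def by blast
  then have P_eq: "PiM I \<nu> = distr M (PiM I \<Lambda>) J"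
    by (simp add: J_eq \<nu>_def cong: PiM_cong)
  have prob_eq: "measure (PiM I \<nu>) A = measure M {\<omega> \<in> space M. J \<omega> \<in> A}" if "A \<in> sets (PiM I \<Lambda>)" for A
    unfolding P_eq using that by (subst measure_distr) (auto simp: vimage_def Int_def conj_commute)
  have J_space: "J \<omega> \<in> space (PiM I \<Lambda>)" if "\<omega> \<in> space M" for \<omega>
    using measurable_space[OF J_meas that] .
  have \<Gamma> [measurable]: "\<Gamma> \<in> sets (PiM I \<Lambda>)" using assms(4) by (simp add: I_def)
  have \<gamma>: "0 < \<gamma> k \<and> \<gamma> k \<le> 1" if "k \<in> I" for k using assms(5) that by (simp add: I_def)
  define h :: "_ \<Rightarrow> real" where "h = indicator (space (PiM I \<nu>) - \<Gamma>)"
  have h: "bounded_measurable (PiM I \<nu>) h"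
    unfolding h_def by (rule bounded_measurable_indicator) (simp add: sets_P space_P sets.compl_sets)
  have good [measurable]: "Measurable.pred (PiM I \<Lambda>) (suffix_avgs_le \<nu> h \<gamma> js)"
    using pred_good[OF h, of js \<gamma>] js(1) measurable_cong_sets[OF sets_P refl] by auto
  \<comment> \<open>\<open>B\<close> is built from \<Gamma>, \<gamma> and the laws
    \<open>\<nu>\<close> alone, hence fixed before \<open>G\<close>, \<open>f\<close>,
    \<open>c\<close>, \<open>d\<close>, \<open>s\<close> and \<open>t\<close> are chosen.\<close>
  define B where "B = {x \<in> space (PiM I \<Lambda>). \<not> (x \<in> \<Gamma> \<and> suffix_avgs_le \<nu> h \<gamma> js x)}"
  have B [measurable]: "B \<in> sets (PiM I \<Lambda>)" unfolding B_def by measurable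
  have not_\<Gamma>: "measure (PiM I \<nu>) (space (PiM I \<nu>) - \<Gamma>) = measure M {\<omega> \<in> space M. J \<omega> \<notin> \<Gamma>}"
    unfolding space_P using J_space
    by (subst prob_eq) (auto intro!: arg_cong[where f = "measure M"])
  have B_bound: "measure M {\<omega> \<in> space M. J \<omega> \<in> B}
      \<le> (\<Sum>k\<in>I. inverse (\<gamma> k)) * measure M {\<omega> \<in> space M. J \<omega> \<notin> \<Gamma>}"
  proof -
    have "measure (PiM I \<nu>) B \<le> (\<Sum>k\<in>I. inverse (\<gamma> k)) * measure (PiM I \<nu>) (space (PiM I \<nu>) - \<Gamma>)"
      unfolding B_def h_def space_P[symmetric]
      by (rule prob_not_typical_le[OF _ js \<gamma>]) (simp_all add: sets_P)
    then show ?thesis unfolding prob_eq[OF B] not_\<Gamma> .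
  qed
  have deviation: "measure M {\<omega> \<in> space M.
        (\<integral>\<omega>. f (J \<omega>) \<partial>M) + t + s * measure M {\<omega> \<in> space M. J \<omega> \<notin> \<Gamma>} \<le> f (J \<omega>) \<and> J \<omega> \<notin> B}
      \<le> gaussian_tail (\<Sum>k\<in>I. (c k + \<gamma> k * (d k - c k))\<^sup>2) t"
    if G: "\<forall>k\<in>I. G k \<in> sets (\<Lambda> k)" and \<Gamma>G: "\<Gamma> \<subseteq> PiE I G"
      and f [measurable]: "f \<in> borel_measurable (PiM I \<Lambda>)" and cd: "\<forall>k\<in>I. c k \<le> d k"
      and lip: "\<forall>k\<in>I. \<forall>x\<in>PiE I G. \<forall>y\<in>PiE I G.
        differ_only_at N k x y \<longrightarrow> \<bar>f x - f y\<bar> \<le> (if x \<in> \<Gamma> then c k else d k)"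
      and osc: "\<forall>x\<in>space (PiM I \<Lambda>). \<forall>y\<in>space (PiM I \<Lambda>). \<bar>f x - f y\<bar> \<le> s"
      and t: "0 \<le> t"
    for G f c d s t
  proof -
    define A where "A = {x \<in> space (PiM I \<nu>).
        (\<integral>x. f x \<partial>PiM I \<nu>) + t + s * measure (PiM I \<nu>) (space (PiM I \<nu>) - \<Gamma>) \<le> f x \<and>
        x \<in> \<Gamma> \<and> suffix_avgs_le \<nu> h \<gamma> js x}"
    have A: "A \<in> sets (PiM I \<Lambda>)" unfolding A_def space_P by measurable
    have mean: "(\<integral>x. f x \<partial>PiM I \<nu>) = (\<integral>\<omega>. f (J \<omega>) \<partial>M)"
      unfolding P_eq by (rule integral_distr) measurable
    have "measure (PiM I \<nu>) A \<le> gaussian_tail (\<Sum>k\<in>I. (c k + \<gamma> k * (d k - c k))\<^sup>2) t"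
      unfolding A_def h_def
    proof (rule prob_typical_deviation_le[OF _ js(1,2) \<gamma> _ \<Gamma>G])
      show "\<Gamma> \<in> sets (PiM I \<nu>)" using \<Gamma> by (simp add: sets_P)
      show "f \<in> borel_measurable (PiM I \<nu>)" using f by (simp only: measurable_cong_sets[OF sets_P refl])
      show "\<bar>f x - f y\<bar> \<le> (if x \<in> \<Gamma> then c k else d k)"
        if "k \<in> I" "x \<in> PiE I G" "y \<in> PiE I G" "x k \<noteq> y k" "\<And>j. j \<in> I - {k} \<Longrightarrow> x j = y j" for k x y
        using lip that unfolding differ_only_at_def I_def by blast
    qed (use G cd osc t in \<open>auto simp: sets_\<nu> space_P\<close>)
    moreover have "{\<omega> \<in> space M. J \<omega> \<in> A} = {\<omega> \<in> space M.
        (\<integral>\<omega>. f (J \<omega>) \<partial>M) + t + s * measure M {\<omega> \<in> space M. J \<omega> \<notin> \<Gamma>} \<le> f (J \<omega>) \<and> J \<omega> \<notin> B}"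
      unfolding A_def not_\<Gamma> mean unfolding B_def space_P using J_space by auto
    ultimately show ?thesis by (simp add: prob_eq[OF A])
  qed
  show ?thesis
    unfolding Let_def I_def[symmetric] J_def[symmetric]
    using B_bound deviation by (intro bexI[OF _ B] conjI allI impI) (auto simp: B_def)
qed

end
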